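(* Consider named agents in the asynchronous model with full-duplex links, with either CW whiteboards or NW whiteboards. In each of these two models the quiescence number of the $k$-gossip problem is $-1$; that is, no self-stabilizing solution (not even a $0$-quiescent one) exists.
   Context: Network: a finite connected graph $G=(V,E)$. Nodes are anonymous (nodes of the same degree are identical). Each node labels its incident links with locally distinct labels; nothing else is assumed about the labels. Each node has a whiteboard (a public memory). Agents: $k$ mobile agents, each a deterministic state machine, are present at all times. In the named agent model each agent has a unique constant identifier from an infinite totally ordered domain (e.g. $\mathbb{N}$). When an agent at a node executes its action, it may change its state, write on the node's whiteboard, and move to a neighboring node (or stay), based only on: its own state (and identifier), the states of the agents currently at the same node, the local link labels of the node (and possibly the label of the incoming link), and the contents of the node's whiteboard. The algorithm is the same for all agents; it is given neither $k$ nor the network. Asynchronous model: there is no bound on the number of moves an agent can make between two moves of another agent, but each agent is always eventually allowed to execute its action; agents at the same node act sequentially, agents at different nodes may act concurrently. Full-duplex links: two agents at neighboring nodes can swap positions simultaneously over the link joining them, crossing in opposite directions without meeting. Whiteboards. NW: no information can be stored. CW: only control information can be stored, not gossip information. $k$-gossip problem: each of the $k$ agents is given an initial piece of information (gossip information), treated as opaque. With CW or NW whiteboards, gossip information is transferred from agent to agent only by meeting at a node; agents may relay all gossip information collected. The goal is that every agent obtains the gossip information of all agents. Self-stabilizing solution: one algorithm, not depending on $k$ or on the network, such that for every network, every number of agents, and every initial configuration (arbitrary agent locations and states, arbitrary whiteboard contents), in every execution every agent eventually knows the gossip information of all agents in the system. $l$-quiescent (for an integer $l$, when $k$ agents are present):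 every execution with $k$ agents reaches a configuration after which $l$ or more agents remain still (never move) forever. The quiescence number of the $k$-gossip problem in a model is the maximum integer $l$ such that an $l$-quiescent self-stabilizing solution exists, and it is $-1$ if no $0$-quiescent self-stabilizing solution exists. *)

theory Defs
  imports "Graph_Theory.Digraph_Component"
begin

text \<open>
  A network is a finite connected simple graph, given as a symmetric loop-free set of arcs,
  together with the labels of the links: \<open>link_label N u v\<close> is the label that node \<open>u\<close>
  gives to the link joining \<open>u\<close> and \<open>v\<close>. Labels are only locally distinct; the two ends
  of a link are labelled independently.
\<close>

record network =
  topology :: "nat pair_pre_digraph"
  link_label :: "nat \<Rightarrow> nat \<Rightarrow> nat"

definition nodes :: "network \<Rightarrow> nat set" where
  "nodes N = pverts (topology N)"

definition neighbours :: "network \<Rightarrow> nat \<Rightarrow> nat set" where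
  "neighbours N u = {v. (u, v) \<in> parcs (topology N)}"

definition local_labels :: "network \<Rightarrow> nat \<Rightarrow> nat set" where
  "local_labels N u = link_label N u ` neighbours N u"

definition is_network :: "network \<Rightarrow> bool" where
  "is_network N \<longleftrightarrow>
     pair_graph (topology N) \<and> connected (with_proj (topology N)) \<and>
     (\<forall>u \<in> nodes N. inj_on (link_label N u) (neighbours N u))"

text \<open>Labels that do not occur at the current node are treated as a decision to stay.\<close>

fun destination :: "network \<Rightarrow> nat \<Rightarrow> nat option \<Rightarrow> nat" where
  "destination N u None = u"
| "destination N u (Some p) =
     (if p \<in> local_labels N u then (THE v. v \<in> neighbours N u \<and> link_label N u v = p) else u)"

datatype whiteboard_model = NW | CW

text \<open>
  Agents are denoted by their identifiers. Pieces of gossip information are opaque, so a piece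
  is represented by the identifier of the agent to which it was given, and the gossip memory
  of an agent is the set of the pieces it holds. The control state (type \<open>'s\<close>) and the
  whiteboard contents (type \<open>'w\<close>) are arbitrary.

  A view is everything on which an agent may base its action. It does not contain the
  (anonymous) node. The component \<open>present\<close> describes the other agents at the same node, and
  \<open>in_label\<close> is the label, at the current node, of the link over which the agent last arrived.
\<close>

record ('id, 's, 'w) view =
  self :: 'id
  own_state :: 's
  own_gossip :: "'id set"
  present :: "('id \<times> 's \<times> 'id set) set"
  labels :: "nat set"
  in_label :: "nat option"
  board :: "'w option"

text \<open>
  The result of an action: new control state, new contents of the whiteboard of the current
  node, and the label of the link over which to leave (\<open>None\<close> to stay).
\<close>

type_synonym ('id, 's, 'w) algorithm = "('id, 's, 'w) view \<Rightarrow> 's \<times> 'w \<times> nat option"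

record ('id, 's, 'w) config =
  loc :: "'id \<Rightarrow> nat"
  state :: "'id \<Rightarrow> 's"
  gossip :: "'id \<Rightarrow> 'id set"
  arrival :: "'id \<Rightarrow> nat option"
  whiteboard :: "nat \<Rightarrow> 'w"

text \<open>
  Arbitrary initial configurations, for the set \<open>I\<close> of agents. Gossip memories may contain
  anything (even pieces of non-existent agents), but an agent always has its own piece.
  Values outside \<open>I\<close> and outside the network are irrelevant.
\<close>

definition initial_config :: "network \<Rightarrow> 'id set \<Rightarrow> ('id, 's, 'w) config \<Rightarrow> bool" where
  "initial_config N I C \<longleftrightarrow>
     (\<forall>a \<in> I. loc C a \<in> nodes N \<and> finite (gossip C a) \<and> a \<in> gossip C a \<and>
              (\<forall>p. arrival C a = Some p \<longrightarrow> p \<in> local_labels N (loc C a)))"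

definition view_of ::
  "whiteboard_model \<Rightarrow> network \<Rightarrow> 'id set \<Rightarrow> ('id, 's, 'w) config \<Rightarrow> 'id \<Rightarrow> ('id, 's, 'w) view" where
  "view_of M N I C a =
     \<lparr> self = a,
       own_state = state C a,
       own_gossip = gossip C a,
       present = {(b, state C b, gossip C b) | b. b \<in> I \<and> b \<noteq> a \<and> loc C b = loc C a},
       labels = local_labels N (loc C a),
       in_label = arrival C a,
       board = (case M of NW \<Rightarrow> None | CW \<Rightarrow> Some (whiteboard C (loc C a))) \<rparr>"

text \<open>
  The configuration after the agents in \<open>S\<close> have acted concurrently (\<open>S\<close> contains at most one
  agent per node, see below). All of them read the configuration \<open>C\<close>. An acting agent collects
  all gossip information held by the agents at its node. As links are full-duplex, two agents
  in \<open>S\<close> at neighbouring nodes may swap positions without meeting. With NW whiteboards, nothing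
  is read (see \<open>view_of\<close>) and nothing is stored.
\<close>

definition step ::
  "whiteboard_model \<Rightarrow> network \<Rightarrow> 'id set \<Rightarrow> ('id, 's, 'w) algorithm \<Rightarrow> 'id set \<Rightarrow>
   ('id, 's, 'w) config \<Rightarrow> ('id, 's, 'w) config" where
  "step M N I A S C =
     (let result = (\<lambda>a. A (view_of M N I C a));
          next_state = (\<lambda>a. fst (result a));
          written = (\<lambda>a. fst (snd (result a)));
          next_loc = (\<lambda>a. destination N (loc C a) (snd (snd (result a))))
      in \<lparr> loc = (\<lambda>a. if a \<in> S then next_loc a else loc C a),
           state = (\<lambda>a. if a \<in> S then next_state a else state C a),
           gossip = (\<lambda>a. if a \<in> S then (\<Union>b \<in> {b \<in> I. loc C b = loc C a}. gossip C b)
                         else gossip C a),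
           arrival = (\<lambda>a. if a \<in> S \<and> next_loc a \<noteq> loc C a
                          then Some (link_label N (next_loc a) (loc C a)) else arrival C a),
           whiteboard = (\<lambda>v. if M = CW \<and> (\<exists>a \<in> S. loc C a = v)
                             then written (THE a. a \<in> S \<and> loc C a = v)
                             else whiteboard C v) \<rparr>)"

text \<open>
  Asynchronous executions: agents at the same node act sequentially, agents at different nodes
  may act concurrently, and every agent acts infinitely often.
\<close>

definition execution ::
  "whiteboard_model \<Rightarrow> network \<Rightarrow> 'id set \<Rightarrow> ('id, 's, 'w) algorithm \<Rightarrow>
   (nat \<Rightarrow> ('id, 's, 'w) config) \<Rightarrow> bool" where
  "execution M N I A C \<longleftrightarrow>
     initial_config N I (C 0) \<and>
     (\<exists>S. (\<forall>t. S t \<subseteq> I \<and> inj_on (loc (C t)) (S t) \<and> C (Suc t) = step M N I A (S t) (C t)) \<and>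
          (\<forall>a \<in> I. \<forall>t. \<exists>t' \<ge> t. a \<in> S t'))"

definition self_stabilizing_gossip ::
  "whiteboard_model \<Rightarrow> ('id, 's, 'w) algorithm \<Rightarrow> bool" where
  "self_stabilizing_gossip M A \<longleftrightarrow>
     (\<forall>N I C. is_network N \<and> finite I \<and> I \<noteq> {} \<and> execution M N I A C \<longrightarrow>
        (\<forall>a \<in> I. \<exists>t. I \<subseteq> gossip (C t) a))"

text \<open>There are no loops, so an agent moves in a step iff its location changes.\<close>

definition quiescent ::
  "whiteboard_model \<Rightarrow> ('id, 's, 'w) algorithm \<Rightarrow> nat \<Rightarrow> int \<Rightarrow> bool" where
  "quiescent M A k l \<longleftrightarrow>
     (\<forall>N I C. is_network N \<and> finite I \<and> I \<noteq> {} \<and> card I = k \<and> execution M N I A C \<longrightarrow>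
        (\<exists>T. l \<le> int (card {a \<in> I. \<forall>t \<ge> T. loc (C t) a = loc (C T) a})))"

definition quiescent_solution ::
  "whiteboard_model \<Rightarrow> ('id, 's, 'w) algorithm \<Rightarrow> nat \<Rightarrow> int \<Rightarrow> bool" where
  "quiescent_solution M A k l \<longleftrightarrow> self_stabilizing_gossip M A \<and> quiescent M A k l"

text \<open>The type argument fixes the types of identifiers, control states and whiteboard contents.\<close>

definition quiescence_number ::
  "('id, 's, 'w) algorithm itself \<Rightarrow> whiteboard_model \<Rightarrow> nat \<Rightarrow> int" where
  "quiescence_number _ M k =
     (if \<exists>A :: ('id, 's, 'w) algorithm. quiescent_solution M A k 0
      then (GREATEST l. \<exists>A :: ('id, 's, 'w) algorithm. quiescent_solution M A k l)
      else -1)"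

end

theory Submission
  imports Defs
begin

text \<open>
  On the network with two nodes and one link, call an identifier restful if an agent with this
  identifier that holds only its own piece has, as long as it is alone at its node, some local
  situation from which it never leaves. If two identifiers are restful, start the two agents at
  different nodes in such situations. Otherwise two identifiers are not restful: let each agent
  act on its own until it is about to leave, and once both are, let them swap positions. Either
  way the two agents never meet.
\<close>

section \<open>The two-node network\<close>

definition link_network :: network where
  "link_network = \<lparr> topology = \<lparr> pverts = {0, 1}, parcs = {(0, 1), (1, 0)} \<rparr>,
                    link_label = (\<lambda>_ _. 0) \<rparr>"

lemma nodes_link_network [simp]: "nodes link_network = {0, 1}"
  by (simp add: nodes_def link_network_def)

lemma link_label_link_network [simp]: "link_label link_network u v = 0"
  by (simp add: link_network_def)

lemma neighbours_link_network: "u \<in> {0, 1} \<Longrightarrow> neighbours link_network u = {1 - u}"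
  by (auto simp: neighbours_def link_network_def)

lemma local_labels_link_network: "u \<in> {0, 1} \<Longrightarrow> local_labels link_network u = {0}"
  by (simp add: local_labels_def neighbours_link_network)

lemma destination_link_network:
  "u \<in> {0, 1} \<Longrightarrow> destination link_network u d = (if d = Some 0 then 1 - u else u)"
  by (cases d) (auto simp: local_labels_link_network neighbours_link_network)

lemma is_network_link_network: "is_network link_network"
proof -
  let ?T = "topology link_network"
  have pair: "pair_graph ?T"
    by unfold_locales (auto simp: link_network_def symmetric_def sym_def)
  interpret pair_graph ?T by (fact pair)
  have "u \<rightarrow>\<^sup>*\<^bsub>with_proj ?T\<^esub> v" if "u \<in> {0, 1}" "v \<in> {0, 1}" for u v
  proof (cases "u = v")
    case True
    moreover have "u \<in> verts (with_proj ?T)"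
      using that by (auto simp: link_network_def)
    ultimately show ?thesis
      by (simp add: reachable_refl)
  next
    case False
    then have "(u, v) \<in> parcs ?T"
      using that by (auto simp: link_network_def)
    then show ?thesis
      by (intro reachable_adjI) simp
  qed
  moreover have "verts (with_proj ?T) = {0, 1}"
    by (simp add: link_network_def)
  \<comment> \<open>\<open>connected\<close> asks for strong connectivity of the symmetric closure;
    the arcs are symmetric already, so reachability is the same in both.\<close>
  ultimately have "connected (with_proj ?T)"
    unfolding connected_def
    by (intro strongly_connectedI) (auto simp: reachable_mk_symmetric_eq sym_arcs)
  then show ?thesis
    using pair by (auto simp: is_network_def neighbours_link_network)
qed

section \<open>Behaviour of an agent alone at its node\<close>

text \<open>Both nodes of \<open>link_network\<close> have the label set \<open>{0}\<close>, so a
  lone agent cannot tell them apart. The pair \<open>x\<close> holds its control state and the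
  contents of the whiteboard at its node.\<close>

definition solo_action ::
  "whiteboard_model \<Rightarrow> ('id, 's, 'w) algorithm \<Rightarrow> 'id \<Rightarrow> nat option \<Rightarrow> 's \<times> 'w \<Rightarrow> 's \<times> 'w \<times> nat option"
  where
  "solo_action M A a r x =
     A \<lparr> self = a, own_state = fst x, own_gossip = {a}, present = {}, labels = {0}, in_label = r,
         board = (case M of NW \<Rightarrow> None | CW \<Rightarrow> Some (snd x)) \<rparr>"

text \<open>For \<open>NW\<close> the second component is inert; carrying it along lets one type
  serve both models.\<close>

definition solo_step ::
  "whiteboard_model \<Rightarrow> ('id, 's, 'w) algorithm \<Rightarrow> 'id \<Rightarrow> nat option \<Rightarrow> 's \<times> 'w \<Rightarrow> 's \<times> 'w" where
  "solo_step M A a r x =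
     (fst (solo_action M A a r x),
      case M of NW \<Rightarrow> snd x | CW \<Rightarrow> fst (snd (solo_action M A a r x)))"

definition leaves ::
  "whiteboard_model \<Rightarrow> ('id, 's, 'w) algorithm \<Rightarrow> 'id \<Rightarrow> nat option \<Rightarrow> 's \<times> 'w \<Rightarrow> bool" where
  "leaves M A a r x \<longleftrightarrow> snd (snd (solo_action M A a r x)) = Some 0"

definition resting ::
  "whiteboard_model \<Rightarrow> ('id, 's, 'w) algorithm \<Rightarrow> 'id \<Rightarrow> nat option \<Rightarrow> 's \<times> 'w \<Rightarrow> bool" where
  "resting M A a r x \<longleftrightarrow> (\<forall>n. \<not> leaves M A a r ((solo_step M A a r ^^ n) x))"

text \<open>On \<open>link_network\<close> no other arrival labels are possible. Since initial
  configurations are arbitrary, any witness \<open>r\<close>, \<open>x\<close> can be planted at the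
  start of an execution.\<close>

definition restful :: "whiteboard_model \<Rightarrow> ('id, 's, 'w) algorithm \<Rightarrow> 'id \<Rightarrow> bool" where
  "restful M A a \<longleftrightarrow> (\<exists>r \<in> {None, Some 0}. \<exists>x. resting M A a r x)"

lemma resting_not_leaves: "resting M A a r x \<Longrightarrow> \<not> leaves M A a r x"
  unfolding resting_def by (metis funpow_0)

lemma resting_solo_step: "resting M A a r x \<Longrightarrow> resting M A a r (solo_step M A a r x)"
  unfolding resting_def by (metis comp_apply funpow_Suc_right)

section \<open>A schedule that keeps two agents apart\<close>

locale two_agents =
  fixes M :: whiteboard_model and A :: "('id, 's, 'w) algorithm" and p q :: 'id
  assumes distinct_agents: "p \<noteq> q"
begin

text \<open>The invariant of the constructed runs. It fixes the gossip memories because they are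
  visible in views and \<open>solo_action\<close> presupposes \<open>{a}\<close>.\<close>

definition separated :: "('id, 's, 'w) config \<Rightarrow> bool" where
  "separated C \<longleftrightarrow> loc C p \<noteq> loc C q \<and>
     (\<forall>a \<in> {p, q}. loc C a \<in> {0, 1} \<and> gossip C a = {a} \<and> arrival C a \<in> {None, Some 0})"

definition situation :: "('id, 's, 'w) config \<Rightarrow> 'id \<Rightarrow> 's \<times> 'w" where
  "situation C a = (state C a, whiteboard C (loc C a))"

definition wants :: "('id, 's, 'w) config \<Rightarrow> 'id \<Rightarrow> bool" where
  "wants C a \<longleftrightarrow> leaves M A a (arrival C a) (situation C a)"

text \<open>The schedule: an agent that left alone would meet the other one, so it is suspended
  until both want to leave. Then both act concurrently and cross on the full-duplex link.\<close>

definition active :: "('id, 's, 'w) config \<Rightarrow> 'id set" where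
  "active C = {a \<in> {p, q}. wants C a \<longrightarrow> wants C p \<and> wants C q}"

definition next_config :: "('id, 's, 'w) config \<Rightarrow> ('id, 's, 'w) config" where
  "next_config C = step M link_network {p, q} A (active C) C"

definition run :: "('id, 's, 'w) config \<Rightarrow> nat \<Rightarrow> ('id, 's, 'w) config" where
  "run C t = (next_config ^^ t) C"

lemma run_0 [simp]: "run C 0 = C"
  and run_Suc: "run C (Suc t) = next_config (run C t)"
  by (simp_all add: run_def)

lemma separated_eq:
  "separated C \<Longrightarrow> a \<in> {p, q} \<Longrightarrow> b \<in> {p, q} \<Longrightarrow> loc C a = loc C b \<longleftrightarrow> a = b"
  by (auto simp: separated_def)

lemma action_separated:
  assumes "separated C" "a \<in> {p, q}"
  shows "A (view_of M link_network {p, q} C a) = solo_action M A a (arrival C a) (situation C a)"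
proof -
  have alone: "{(b, state C b, gossip C b) |b. b \<in> {p, q} \<and> b \<noteq> a \<and> loc C b = loc C a} = {}"
    using assms separated_eq by blast
  have "local_labels link_network (loc C a) = {0}" "gossip C a = {a}"
    using assms by (auto simp: separated_def local_labels_link_network)
  then show ?thesis
    unfolding view_of_def alone by (cases M) (simp_all add: solo_action_def situation_def)
qed

text \<open>An agent that wants to leave acts only together with the other one, and then both do
  leave.\<close>

lemma loc_next_config:
  assumes "separated C" "a \<in> {p, q}"
  shows "loc (next_config C) a = (if wants C p \<and> wants C q then 1 - loc C a else loc C a)"
proof -
  have "loc C a \<in> {0, 1}"
    using assms by (auto simp: separated_def)
  then show ?thesis
    using assms action_separated[OF assms]
    by (auto simp: next_config_def step_def Let_def active_def wants_def leaves_def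
        destination_link_network)
qed

lemma gossip_next_config:
  assumes "separated C" "a \<in> {p, q}"
  shows "gossip (next_config C) a = {a}"
proof -
  have "{b \<in> {p, q}. loc C b = loc C a} = {a}"
    using assms separated_eq by blast
  then have "(\<Union>b \<in> {b \<in> {p, q}. loc C b = loc C a}. gossip C b) = gossip C a"
    by simp
  then show ?thesis
    using assms by (auto simp: next_config_def step_def Let_def separated_def)
qed

lemma arrival_next_config:
  "arrival (next_config C) a \<in> {arrival C a, Some 0}"
  "loc (next_config C) a = loc C a \<Longrightarrow> arrival (next_config C) a = arrival C a"
  by (auto simp: next_config_def step_def Let_def)

lemma separated_next_config:
  assumes "separated C"
  shows "separated (next_config C)"
proof -
  have "loc (next_config C) p \<noteq> loc (next_config C) q"
    using assms by (auto simp: loc_next_config separated_def)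
  moreover have "loc (next_config C) a \<in> {0, 1} \<and> gossip (next_config C) a = {a} \<and>
      arrival (next_config C) a \<in> {None, Some 0}" if "a \<in> {p, q}" for a
  proof -
    have "loc C a \<in> {0, 1}" "arrival C a \<in> {None, Some 0}"
      using assms that by (auto simp: separated_def)
    then show ?thesis
      using assms that arrival_next_config(1)[of C a]
      by (auto simp: loc_next_config gossip_next_config)
  qed
  ultimately show ?thesis
    unfolding separated_def by simp
qed

lemma separated_run: "separated C \<Longrightarrow> separated (run C t)"
  by (induction t) (simp_all add: run_Suc separated_next_config)

text \<open>Such an agent is never suspended, and nobody else writes on its whiteboard, so the other
  agent has no influence on it.\<close>

lemma next_config_not_wants:
  assumes "separated C" "a \<in> {p, q}" "\<not> wants C a"
  shows "arrival (next_config C) a = arrival C a"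
    and "situation (next_config C) a = solo_step M A a (arrival C a) (situation C a)"
proof -
  have stay: "loc (next_config C) a = loc C a"
    using assms by (auto simp: loc_next_config)
  then show "arrival (next_config C) a = arrival C a"
    by (rule arrival_next_config(2))
  have act: "a \<in> active C"
    using assms by (simp add: active_def)
  have "b = a" if "b \<in> active C" "loc C b = loc C a" for b
    using that assms separated_eq[of C b a] by (auto simp: active_def)
  \<comment> \<open>\<open>step\<close> selects the writer at a node by \<open>THE\<close>;
    separation makes it unique.\<close>
  then have the_a: "(THE b. b \<in> active C \<and> loc C b = loc C a) = a"
    using act by blast
  have "state (next_config C) a = fst (solo_action M A a (arrival C a) (situation C a))"
    using act action_separated[OF assms(1,2)] by (simp add: next_config_def step_def Let_def)
  moreover have "whiteboard (next_config C) (loc C a) =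
      (case M of NW \<Rightarrow> whiteboard C (loc C a)
       | CW \<Rightarrow> fst (snd (solo_action M A a (arrival C a) (situation C a))))"
    using act the_a action_separated[OF assms(1,2)]
    by (auto simp: next_config_def step_def Let_def split: whiteboard_model.split)
  ultimately show "situation (next_config C) a = solo_step M A a (arrival C a) (situation C a)"
    using stay by (cases M) (simp_all add: solo_step_def situation_def)
qed

lemma resting_run:
  assumes "separated C" "a \<in> {p, q}" "resting M A a (arrival C a) (situation C a)"
  shows "resting M A a (arrival (run C t) a) (situation (run C t) a)"
proof (induction t)
  case (Suc t)
  then have "\<not> wants (run C t) a"
    unfolding wants_def by (rule resting_not_leaves)
  then show ?case
    using Suc assms by (simp add: run_Suc next_config_not_wants separated_run resting_solo_step)
qed (use assms in simp)

text \<open>The situation at time \<open>T\<close> is the witness: from then on the run follows the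
  orbit of \<open>solo_step\<close>, with a constant arrival label.\<close>

lemma restful_if_never_wants:
  assumes "separated C" "a \<in> {p, q}" "\<And>t. t \<ge> T \<Longrightarrow> \<not> wants (run C t) a"
  shows "restful M A a"
proof -
  let ?r = "arrival (run C T) a" and ?x = "situation (run C T) a"
  have orbit: "arrival (run C (T + n)) a = ?r \<and>
      situation (run C (T + n)) a = (solo_step M A a ?r ^^ n) ?x" for n
  proof (induction n)
    case (Suc n)
    have "\<not> wants (run C (T + n)) a"
      using assms(3) by simp
    then show ?case
      using Suc next_config_not_wants[OF separated_run[OF assms(1)] assms(2)]
      by (simp add: run_Suc)
  qed simp
  have "\<not> leaves M A a ?r ((solo_step M A a ?r ^^ n) ?x)" for n
    using assms(3)[of "T + n"] orbit[of n] by (simp add: wants_def)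
  then have "resting M A a ?r ?x"
    by (simp add: resting_def)
  moreover have "?r \<in> {None, Some 0}"
    using separated_run[OF assms(1), of T] assms(2) by (auto simp: separated_def)
  ultimately show ?thesis
    unfolding restful_def by blast
qed

section \<open>From fair schedules to failing executions\<close>

text \<open>Separation yields everything except fairness, which is left to the two cases
  below.\<close>

lemma execution_run:
  assumes "separated C"
    and "\<And>a t. a \<in> {p, q} \<Longrightarrow> \<exists>t' \<ge> t. a \<in> active (run C t')"
  shows "execution M link_network {p, q} A (run C)"
  unfolding execution_def
proof (intro conjI exI[of _ "\<lambda>t. active (run C t)"] allI ballI)
  show "initial_config link_network {p, q} (run C 0)"
    using assms(1) by (auto simp: initial_config_def separated_def local_labels_link_network)
  show "active (run C t) \<subseteq> {p, q}" for t
    by (auto simp: active_def)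
  show "inj_on (loc (run C t)) (active (run C t))" for t
    using separated_eq[OF separated_run[OF assms(1)]]
    by (intro inj_onI) (auto simp: active_def)
  show "run C (Suc t) = step M link_network {p, q} A (active (run C t)) (run C t)" for t
    by (simp add: run_Suc next_config_def)
  show "\<exists>t' \<ge> t. a \<in> active (run C t')" if "a \<in> {p, q}" for a t
    using assms(2) that .
qed

lemma not_self_stabilizing:
  assumes "separated C" "execution M link_network {p, q} A (run C)"
  shows "\<not> self_stabilizing_gossip M A"
proof
  assume stabilizing: "self_stabilizing_gossip M A"
  have "\<exists>t. {p, q} \<subseteq> gossip (run C t) p"
    by (rule stabilizing[unfolded self_stabilizing_gossip_def, rule_format, of link_network])
      (simp_all add: assms(2) is_network_link_network)
  then obtain t where "{p, q} \<subseteq> gossip (run C t) p" ..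
  then show False
    using separated_run[OF assms(1), of t] distinct_agents by (simp add: separated_def)
qed

text \<open>Each agent gets its own node, and the whiteboard there is filled from its own pair, so
  the two situations can be prescribed independently.\<close>

definition start :: "('id \<Rightarrow> nat option) \<Rightarrow> ('id \<Rightarrow> 's \<times> 'w) \<Rightarrow> ('id, 's, 'w) config" where
  "start r x = \<lparr> loc = (\<lambda>a. if a = p then 0 else 1), state = (\<lambda>a. fst (x a)),
     gossip = (\<lambda>a. {a}), arrival = r, whiteboard = (\<lambda>v. snd (x (if v = 0 then p else q))) \<rparr>"

lemma separated_start: "r ` {p, q} \<subseteq> {None, Some 0} \<Longrightarrow> separated (start r x)"
  using distinct_agents by (auto simp: separated_def start_def)

lemma situation_start: "a \<in> {p, q} \<Longrightarrow> situation (start r x) a = x a"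
  using distinct_agents by (auto simp: situation_def start_def)

text \<open>Agents planted in resting situations never want to leave, so both are active at every
  step and fairness is immediate.\<close>

lemma both_restful:
  assumes "restful M A p" "restful M A q"
  shows "\<not> self_stabilizing_gossip M A"
proof -
  have "\<forall>a \<in> {p, q}. \<exists>r x. r \<in> {None, Some 0} \<and> resting M A a r x"
    using assms unfolding restful_def by blast
  then obtain r x where rx: "\<forall>a \<in> {p, q}. r a \<in> {None, Some 0} \<and> resting M A a (r a) (x a)"
    by metis
  let ?C = "start r x"
  have sep: "separated ?C"
    using rx by (intro separated_start) auto
  have "a \<in> active (run ?C t)" if "a \<in> {p, q}" for a t
  proof -
    have "arrival ?C a = r a" "situation ?C a = x a"
      using situation_start[OF that] by (simp_all add: start_def)
    then have "resting M A a (arrival ?C a) (situation ?C a)"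
      using bspec[OF rx that] by simp
    then have "\<not> wants (run ?C t) a"
      unfolding wants_def by (intro resting_not_leaves resting_run sep that)
    then show ?thesis
      using that by (simp add: active_def)
  qed
  then have "execution M link_network {p, q} A (run ?C)"
    using sep by (intro execution_run) auto
  then show ?thesis
    using sep not_self_stabilizing by blast
qed

text \<open>Fairness is the only issue: if one agent were suspended forever, the other would never
  want to leave again and so would be restful.\<close>

lemma none_restful:
  assumes "\<not> restful M A p" "\<not> restful M A q"
  shows "\<not> self_stabilizing_gossip M A"
proof -
  \<comment> \<open>Any separated start would do, hence the arbitrary value
    \<open>undefined\<close>.\<close>
  let ?C = "start (\<lambda>_. None) (\<lambda>_. undefined)"
  have sep: "separated ?C"
    by (rule separated_start) auto
  have "\<exists>t' \<ge> t. a \<in> active (run ?C t')" if a: "a \<in> {p, q}" for a t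
  proof (rule ccontr)
    \<comment> \<open>An agent is suspended only while it wants to leave and the other agent does not.\<close>
    assume "\<not> ?thesis"
    then have suspended: "a \<notin> active (run ?C t')" if "t' \<ge> t" for t'
      using that by blast
    obtain b where b: "b \<in> {p, q}" "{p, q} = {a, b}"
      using a by auto
    have "\<not> wants (run ?C t') b" if "t' \<ge> t" for t'
      using suspended[OF that] a b by (auto simp: active_def)
    then have "restful M A b"
      using restful_if_never_wants[OF sep b(1)] by blast
    then show False
      using assms b(1) by auto
  qed
  then have "execution M link_network {p, q} A (run ?C)"
    using sep by (intro execution_run)
  then show ?thesis
    using sep not_self_stabilizing by blast
qed

end

text \<open>Pigeonhole: of the restful and the other identifiers one class is infinite, so it
  contains two distinct identifiers, to which one of the two cases applies.\<close>

lemma no_self_stabilizing_gossip: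
  fixes A :: "('id, 's, 'w) algorithm"
  assumes "infinite (UNIV :: 'id set)"
  shows "\<not> self_stabilizing_gossip M A"
proof -
  have two: "\<exists>p \<in> S. \<exists>q \<in> S. p \<noteq> q" if "infinite S" for S :: "'id set"
    using infinite_imp_nonempty[OF that] infinite_imp_nonempty[OF infinite_remove[OF that]] by blast
  have "UNIV = {a. restful M A a} \<union> {a. \<not> restful M A a}"
    by blast
  then have "infinite {a. restful M A a} \<or> infinite {a. \<not> restful M A a}"
    using assms by (metis finite_Un)
  then obtain p q where "p \<noteq> q" "restful M A p \<longleftrightarrow> restful M A q"
    using two by blast
  then interpret two_agents M A p q
    by unfold_locales
  show ?thesis
    using \<open>restful M A p \<longleftrightarrow> restful M A q\<close> both_restful none_restful by blast
qed

theorem theorem5: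
  fixes M :: whiteboard_model and k :: nat
  assumes "infinite (UNIV :: 'id::linorder set)"
    and "k \<ge> 1"
  shows "quiescence_number TYPE(('id, 's, 'w) algorithm) M k = -1 \<and>
         (\<nexists>A :: ('id, 's, 'w) algorithm. self_stabilizing_gossip M A)"
  \<comment> \<open>A quiescent solution is self-stabilizing by definition, so
    \<open>quiescence_number\<close> takes its default value -1.\<close>
  using no_self_stabilizing_gossip[OF assms(1)]
  by (auto simp: quiescence_number_def quiescent_solution_def)

end
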